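(* Let $m\ge 2$, $n\ge 2$, $N\ge 1$, let $G=\mathbb{Z}_n$, let $\beta,\kappa\ge 0$, and let $\gamma$ be a path in $B_N$. Then $$\mathbb{E}_{N,\beta,\kappa,\infty}\bigl[L_\gamma(\sigma,\phi)\bigr]\ \ge\ \eta_\kappa^{|\gamma|}.$$ In particular, if $n=2$, then $$\mathbb{E}_{N,\beta,\kappa,\infty}\bigl[L_\gamma(\sigma,\phi)\bigr]\ \ge\ (\tanh 2\kappa)^{|\gamma|}.$$
   Context: Lattice. $B_N=[-N,N]^m\cap\mathbb{Z}^m$. For $k=0,1,2$, $C_k(B_N)$ is the set of oriented vertices, edges, plaquettes (unit $k$-cells with all corners in $B_N$, each cell $c$ occurring with its two orientations $c$ and $-c$), and $C_k(B_N)^+$ is the subset of positively oriented ones. A $k$-chain is a formal integer combination of positively oriented $k$-cells; $q[c]$ is the coefficient of $c$ in $q$, with $q[-c]=-q[c]$; $\operatorname{supp} q=\{c\in C_k(B_N)^+: q[c]\ne 0\}$. The boundary of an edge from $x$ to $y$ is $\partial e=y-x$; the boundary $\partial p$ of an oriented plaquette is the sum of the four oriented edges around it; $\partial$ extends linearly to chains. Forms. $G=\mathbb{Z}_n$ (additive), $\rho$ is a faithful one-dimensional unitary representation of $G$ (e.g. $j\mapsto e^{2\pi i j/n}$). $\Omega^k(B_N,G)$ is the set of functions $\omega:C_k(B_N)\to G$ with $\omega(-c)=-\omega(c)$, extended linearly to chains. For $\sigma\in\Omega^1(B_N,G)$, $d\sigma(p)=\sigma(\partial p)$; for $\phi\in\Omega^0(B_N,G)$,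 $\phi(\partial e)=\phi(y)-\phi(x)$ if $\partial e=y-x$. Model. $\mu_{N,\beta,\kappa,\infty}$ is the probability measure on $\Omega^1(B_N,G)\times\Omega^0(B_N,G)$ with $$\mu_{N,\beta,\kappa,\infty}(\sigma,\phi)\propto\exp\Bigl(\beta\sum_{p\in C_2(B_N)}\rho(d\sigma(p))+\kappa\sum_{e\in C_1(B_N)}\rho\bigl(\sigma(e)-\phi(\partial e)\bigr)\Bigr)$$ (sums over cells of both orientations, so the exponent is real), and $\mathbb{E}_{N,\beta,\kappa,\infty}$ is its expectation. Paths. A path is a 1-chain $\gamma$ with finite connected support and coefficients in $\{-1,0,1\}$ such that either $\partial\gamma=0$ (closed path) or $\partial\gamma=x_2-x_1$ for two vertices $x_1,x_2$ (open path). $|\gamma|=|\operatorname{supp}\gamma|$. The Wilson line observable is $L_\gamma(\sigma,\phi)=\rho(\sigma(\gamma)-\phi(\partial\gamma))$. Functions. For $a\ge 0$ and $j\in[n]=\{0,\dots,n-1\}$ (identified with $\mathbb{Z}_n$): $\psi_a(j)=\sum_{k=0}^\infty \frac{a^{j+kn}}{(j+kn)!}$, $\hat\varphi_a(j)=\sum_{k,k'\in[n],\,k'-k\equiv j \bmod n}\psi_a(k)\psi_a(k')$, $\varphi_a(j)=\hat\varphi_a(j)/\hat\varphi_a(0)$, and $$\eta_a=\min_{j\in\mathbb{Z}_n}\frac{\varphi_a(j+1)}{\varphi_a(j)}\quad(a>0),\qquad \eta_0:=0 .$$ *)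

theory Defs
  imports
    "HOL-Probability.Probability"
    "HOL-Algebra.Elementary_Groups"
    "HOL-Library.Poly_Mapping"
    "HOL-Number_Theory.Cong"
begin

section \<open>The lattice\<close>

text \<open>
  Points of \<open>\<int>\<^sup>m\<close> are functions \<open>nat \<Rightarrow> int\<close> that are \<open>undefined\<close> outside \<open>{..<m}\<close>.
  Positively oriented cells are given by a base point and increasing directions:
  \<open>(x, i)\<close> is the edge from \<open>x\<close> to \<open>x + e\<^sub>i\<close>, and \<open>(x, i, j)\<close> with \<open>i < j\<close> is the
  plaquette spanned by \<open>e\<^sub>i\<close>, \<open>e\<^sub>j\<close> at \<open>x\<close>.
\<close>

type_synonym vertex = "nat \<Rightarrow> int"
type_synonym edge = "vertex \<times> nat"
type_synonym plaquette = "vertex \<times> nat \<times> nat"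

definition shift :: "vertex \<Rightarrow> nat \<Rightarrow> vertex" where
  "shift x i = x(i := x i + 1)"

definition vertices :: "nat \<Rightarrow> nat \<Rightarrow> vertex set" where
  "vertices m N = {..<m} \<rightarrow>\<^sub>E {- int N..int N}"

definition edges :: "nat \<Rightarrow> nat \<Rightarrow> edge set" where
  "edges m N = {(x, i). i < m \<and> {x, shift x i} \<subseteq> vertices m N}"

definition plaquettes :: "nat \<Rightarrow> nat \<Rightarrow> plaquette set" where
  "plaquettes m N = {(x, i, j). i < j \<and> j < m \<and>
     {x, shift x i, shift x j, shift (shift x i) j} \<subseteq> vertices m N}"

datatype 'c oriented = Fwd 'c | Rev 'c

fun opp :: "'c oriented \<Rightarrow> 'c oriented" where
  "opp (Fwd c) = Rev c"
| "opp (Rev c) = Fwd c"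

definition oriented_cells :: "'c set \<Rightarrow> 'c oriented set" where
  "oriented_cells C = Fwd ` C \<union> Rev ` C"


section \<open>Chains and boundaries\<close>

text \<open>
  A chain is a finitely supported integer-valued function on positively oriented cells;
  its support is \<^const>\<open>Poly_Mapping.keys\<close>.
\<close>

type_synonym 'c chain = "'c \<Rightarrow>\<^sub>0 int"

fun chain_of :: "'c oriented \<Rightarrow> 'c chain" where
  "chain_of (Fwd c) = frag_of c"
| "chain_of (Rev c) = - frag_of c"

definition boundary1 :: "edge chain \<Rightarrow> vertex chain" where
  "boundary1 = frag_extend (\<lambda>(x, i). frag_of (shift x i) - frag_of x)"

definition boundary2 :: "plaquette chain \<Rightarrow> edge chain" where
  "boundary2 = frag_extend (\<lambda>(x, i, j).
     chain_of (Fwd (x, i)) + chain_of (Fwd (shift x i, j)) +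
     chain_of (Rev (shift x j, i)) + chain_of (Rev (x, j)))"


section \<open>Forms with values in the integers modulo n\<close>

text \<open>
  For \<open>n > 0\<close> the library group \<^const>\<open>integer_mod_group\<close> has carrier \<open>{0..<int n}\<close>,
  with addition modulo \<open>n\<close>.
\<close>

definition forms :: "nat \<Rightarrow> 'c set \<Rightarrow> ('c oriented \<Rightarrow> int) set" where
  "forms n C = {\<omega> \<in> oriented_cells C \<rightarrow>\<^sub>E carrier (integer_mod_group n).
     \<forall>c \<in> oriented_cells C. \<omega> (opp c) = inv\<^bsub>integer_mod_group n\<^esub> (\<omega> c)}"

definition form_ext :: "nat \<Rightarrow> ('c oriented \<Rightarrow> int) \<Rightarrow> 'c chain \<Rightarrow> int" where
  "form_ext n \<omega> q =
     (\<Sum>c\<in>Poly_Mapping.keys q. Poly_Mapping.lookup q c * \<omega> (Fwd c)) mod int n"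

definition d_form :: "nat \<Rightarrow> (edge oriented \<Rightarrow> int) \<Rightarrow> plaquette oriented \<Rightarrow> int" where
  "d_form n \<sigma> p = form_ext n \<sigma> (boundary2 (chain_of p))"

definition unit_circle_group :: "complex monoid" where
  "unit_circle_group = \<lparr>carrier = {z. norm z = 1}, monoid.mult = (*), one = 1\<rparr>"

definition faithful_unitary_rep :: "nat \<Rightarrow> (int \<Rightarrow> complex) \<Rightarrow> bool" where
  "faithful_unitary_rep n \<rho> \<longleftrightarrow> \<rho> \<in> mon (integer_mod_group n) unit_circle_group"


section \<open>The lattice Higgs measure with unit-length Higgs field\<close>

type_synonym config = "(edge oriented \<Rightarrow> int) \<times> (vertex oriented \<Rightarrow> int)"

definition configs :: "nat \<Rightarrow> nat \<Rightarrow> nat \<Rightarrow> config set" where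
  "configs m n N = forms n (edges m N) \<times> forms n (vertices m N)"

definition exponent ::
  "nat \<Rightarrow> nat \<Rightarrow> nat \<Rightarrow> (int \<Rightarrow> complex) \<Rightarrow> real \<Rightarrow> real \<Rightarrow> config \<Rightarrow> complex" where
  "exponent m n N \<rho> \<beta> \<kappa> = (\<lambda>(\<sigma>, \<phi>).
     of_real \<beta> * (\<Sum>p\<in>oriented_cells (plaquettes m N). \<rho> (d_form n \<sigma> p)) +
     of_real \<kappa> * (\<Sum>e\<in>oriented_cells (edges m N).
       \<rho> ((\<sigma> e - form_ext n \<phi> (boundary1 (chain_of e))) mod int n)))"

text \<open>
  The terms of the two orientations of a cell are complex conjugate, so on
  \<^const>\<open>configs\<close> the exponent is real and taking its real part only changes its type.
\<close>

definition weight ::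
  "nat \<Rightarrow> nat \<Rightarrow> nat \<Rightarrow> (int \<Rightarrow> complex) \<Rightarrow> real \<Rightarrow> real \<Rightarrow> config \<Rightarrow> real" where
  "weight m n N \<rho> \<beta> \<kappa> \<omega> = exp (Re (exponent m n N \<rho> \<beta> \<kappa> \<omega>))"

definition higgs_measure ::
  "nat \<Rightarrow> nat \<Rightarrow> nat \<Rightarrow> (int \<Rightarrow> complex) \<Rightarrow> real \<Rightarrow> real \<Rightarrow> config measure" where
  "higgs_measure m n N \<rho> \<beta> \<kappa> = point_measure (configs m n N)
     (\<lambda>\<omega>. ennreal (weight m n N \<rho> \<beta> \<kappa> \<omega> / (\<Sum>\<omega>'\<in>configs m n N. weight m n N \<rho> \<beta> \<kappa> \<omega>')))"


section \<open>Paths and Wilson lines\<close>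

text \<open>Connectedness of a set of edges: adjacent edges are those sharing an endpoint.\<close>

definition connected_edges :: "edge set \<Rightarrow> bool" where
  "connected_edges S \<longleftrightarrow> (\<forall>e\<in>S. \<forall>e'\<in>S.
     (e, e') \<in> {(a, b). a \<in> S \<and> b \<in> S \<and>
       {fst a, shift (fst a) (snd a)} \<inter> {fst b, shift (fst b) (snd b)} \<noteq> {}}\<^sup>*)"

definition lattice_path :: "nat \<Rightarrow> nat \<Rightarrow> edge chain \<Rightarrow> bool" where
  "lattice_path m N \<gamma> \<longleftrightarrow>
     Poly_Mapping.keys \<gamma> \<subseteq> edges m N \<and>
     connected_edges (Poly_Mapping.keys \<gamma>) \<and>
     (\<forall>e. Poly_Mapping.lookup \<gamma> e \<in> {-1, 0, 1}) \<and>
     (boundary1 \<gamma> = 0 \<or>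
      (\<exists>x1\<in>vertices m N. \<exists>x2\<in>vertices m N. boundary1 \<gamma> = frag_of x2 - frag_of x1))"

definition path_length :: "edge chain \<Rightarrow> nat" where
  "path_length \<gamma> = card (Poly_Mapping.keys \<gamma>)"

definition wilson_line :: "nat \<Rightarrow> (int \<Rightarrow> complex) \<Rightarrow> edge chain \<Rightarrow> config \<Rightarrow> complex" where
  "wilson_line n \<rho> \<gamma> =
     (\<lambda>(\<sigma>, \<phi>). \<rho> ((form_ext n \<sigma> \<gamma> - form_ext n \<phi> (boundary1 \<gamma>)) mod int n))"

definition wilson_expectation ::
  "nat \<Rightarrow> nat \<Rightarrow> nat \<Rightarrow> (int \<Rightarrow> complex) \<Rightarrow> real \<Rightarrow> real \<Rightarrow> edge chain \<Rightarrow> complex" where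
  "wilson_expectation m n N \<rho> \<beta> \<kappa> \<gamma> =
     (LINT \<omega>|higgs_measure m n N \<rho> \<beta> \<kappa>. wilson_line n \<rho> \<gamma> \<omega>)"


section \<open>The lower-bound constant\<close>

definition psi :: "nat \<Rightarrow> real \<Rightarrow> nat \<Rightarrow> real" where
  "psi n a j = suminf (\<lambda>k. a ^ (j + k * n) / fact (j + k * n))"

definition phi_hat :: "nat \<Rightarrow> real \<Rightarrow> nat \<Rightarrow> real" where
  "phi_hat n a j =
     (\<Sum>(k, k') \<in> {(k, k'). k < n \<and> k' < n \<and> [int k' - int k = int j] (mod int n)}.
        psi n a k * psi n a k')"

definition phi_ratio :: "nat \<Rightarrow> real \<Rightarrow> nat \<Rightarrow> real" where
  "phi_ratio n a j = phi_hat n a j / phi_hat n a 0"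

definition eta :: "nat \<Rightarrow> real \<Rightarrow> real" where
  "eta n a = (if a = 0 then 0
     else Min ((\<lambda>j. phi_ratio n a ((j + 1) mod n) / phi_ratio n a j) ` {..<n}))"

end

theory Submission
  imports Defs
begin

text \<open>
  In the unitary gauge the model depends only on \<open>s = \<sigma> - d\<phi>\<close>, the edge factors decouple, and the
  Fourier coefficient of a single edge factor at frequency \<open>k\<close> is a multiple of \<open>phi_hat n \<kappa> k\<close>.
  Expanding the plaquette factor gives a nonnegative combination of characters \<open>\<chi>\<close>, so it suffices to
  compare the Fourier coefficients of the edge weight at \<open>\<chi> \<cdot> L\<^sub>\<gamma>\<close> and at \<open>\<chi>\<close>. They differ by a
  shift of the frequency by \<open>\<plusminus>1\<close> on each edge of \<open>\<gamma>\<close>, and each such shift costs at most a factor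
  \<open>eta n \<kappa>\<close>, the shift by \<open>-1\<close> being reduced to that by \<open>1\<close> through \<open>phi_hat n \<kappa> (-k) = phi_hat n \<kappa> k\<close>.
\<close>

section \<open>Fourier coefficients of the edge weight\<close>

lemma psi_summable:
  fixes a :: real
  assumes "n > 0" and "a \<ge> 0"
  shows "summable (\<lambda>k. a ^ (j + k * n) / fact (j + k * n))"
proof -
  have "summable (\<lambda>k. a ^ k / fact k)"
    using summable_exp[of a] by (simp add: field_simps)
  moreover have "inj (\<lambda>k. j + k * n)"
    using assms by (auto simp: inj_on_def)
  ultimately have "summable ((\<lambda>k. a ^ k / fact k) \<circ> (\<lambda>k. j + k * n))"
    using assms by (intro summable_reindex) auto
  then show ?thesis by (simp add: o_def)
qed

lemma psi_nonneg: "n > 0 \<Longrightarrow> a \<ge> 0 \<Longrightarrow> psi n a j \<ge> 0"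
  unfolding psi_def by (intro suminf_nonneg psi_summable) auto

lemma psi_pos: "n > 0 \<Longrightarrow> a > 0 \<Longrightarrow> psi n a j > 0"
  unfolding psi_def by (intro suminf_pos psi_summable) auto

text \<open>Group the exponential series by the residue of the exponent modulo \<open>n\<close>:
  \<open>z ^ n = 1\<close> makes the power of \<open>z\<close> constant on each class, and the
  remaining real series is \<open>psi\<close>.\<close>

lemma exp_root_of_unity_eq_psi:
  fixes z :: complex
  assumes "n > 0" and "a \<ge> 0" and "z ^ n = 1"
  shows "exp (of_real a * z) = (\<Sum>j<n. of_real (psi n a j) * z ^ j)"
proof -
  have "(\<lambda>k. (of_real a * z) ^ k /\<^sub>R fact k) sums exp (of_real a * z)"
    by (rule exp_converges)
  from sums_group[OF this \<open>n > 0\<close>]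
  have "(\<lambda>k. \<Sum>j<n. (of_real a * z) ^ (j + k * n) /\<^sub>R fact (j + k * n)) sums exp (of_real a * z)"
    by (subst (asm) sum.atLeastLessThan_shift_0) (simp add: atLeast0LessThan add.commute)
  moreover have "(\<lambda>k. \<Sum>j<n. (of_real a * z) ^ (j + k * n) /\<^sub>R fact (j + k * n)) sums
      (\<Sum>j<n. of_real (psi n a j) * z ^ j)"
  proof (rule sums_sum)
    fix j
    have "(\<lambda>k. of_real (a ^ (j + k * n) / fact (j + k * n)) * z ^ j) sums (of_real (psi n a j) * z ^ j)"
      unfolding psi_def by (intro sums_mult2 sums_of_real summable_sums psi_summable assms)
    moreover have "z ^ (j + k * n) = z ^ j" for k
      using assms by (simp add: power_add power_mult mult.commute[of k])
    ultimately show "(\<lambda>k. (of_real a * z) ^ (j + k * n) /\<^sub>R fact (j + k * n)) sums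
        (of_real (psi n a j) * z ^ j)"
      by (simp add: power_mult_distrib scaleR_conv_of_real divide_simps)
  qed
  ultimately show ?thesis by (rule sums_unique2)
qed

section \<open>Cyclic correlations of \<open>psi\<close> and their neighbour ratios\<close>

lemma phi_hat_eq_double_sum:
  "phi_hat n a j = (\<Sum>k<n. \<Sum>k'<n. if [int k' - int k = int j] (mod int n)
     then psi n a k * psi n a k' else 0)"
proof -
  have "{(k, k'). k < n \<and> k' < n \<and> [int k' - int k = int j] (mod int n)} =
      {p \<in> {..<n} \<times> {..<n}. [int (snd p) - int (fst p) = int j] (mod int n)}"
    by auto
  then show ?thesis
    unfolding phi_hat_def sum.cartesian_product
    by (auto simp: sum.inter_filter case_prod_unfold)
qed

lemma phi_hat_nonneg: "n > 0 \<Longrightarrow> a \<ge> 0 \<Longrightarrow> phi_hat n a j \<ge> 0"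
  unfolding phi_hat_eq_double_sum by (intro sum_nonneg) (simp add: psi_nonneg)

lemma phi_hat_pos:
  assumes "n > 0" and "a > 0"
  shows "phi_hat n a j > 0"
proof -
  let ?T = "{(k, k'). k < n \<and> k' < n \<and> [int k' - int k = int j] (mod int n)}"
  have "finite ?T"
    by (rule finite_subset[of _ "{..<n} \<times> {..<n}"]) auto
  \<comment> \<open>Every term is positive, so one admissible pair suffices; \<open>j\<close> is
    reduced because it may exceed \<open>n\<close>.\<close>
  moreover have "(0, j mod n) \<in> ?T"
    using assms by (auto simp: cong_def zmod_int)
  ultimately show ?thesis
    unfolding phi_hat_def using assms by (intro sum_pos) (auto intro: mult_pos_pos psi_pos simp del: mem_Collect_eq)
qed

text \<open>Exchanging the two summation indices changes the sign of their difference. Frequencies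
  are arbitrary integers, so they enter through the representative
  \<open>nat (k mod int n)\<close>.\<close>

lemma phi_hat_uminus: "phi_hat n a (nat ((- k) mod int n)) = phi_hat n a (nat (k mod int n))"
  if "n > 0"
proof -
  have *: "[int k2 - int k1 = int (nat ((- k) mod int n))] (mod int n) \<longleftrightarrow>
      [int k1 - int k2 = int (nat (k mod int n))] (mod int n)" for k1 k2
  proof -
    have "[int k2 - int k1 = - k] (mod int n) \<longleftrightarrow> [- (int k2 - int k1) = - (- k)] (mod int n)"
      by (metis cong_minus_minus_iff)
    then show ?thesis using that by (simp add: cong_def)
  qed
  show ?thesis
    unfolding phi_hat_eq_double_sum *
    by (subst sum.swap) (simp add: mult.commute cong: if_cong)
qed

lemma eta_nonneg:
  assumes "n > 0" and "a \<ge> 0"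
  shows "eta n a \<ge> 0"
  unfolding eta_def phi_ratio_def
  using assms by (auto simp: Min_ge_iff phi_hat_nonneg lessThan_empty_iff)

lemma phi_hat_Suc_ge:
  assumes "n > 0" and "a \<ge> 0"
  shows "phi_hat n a (nat ((k + 1) mod int n)) \<ge> eta n a * phi_hat n a (nat (k mod int n))"
proof (cases "a = 0")
  case True
  \<comment> \<open>The convention \<open>eta n 0 = 0\<close> leaves only nonnegativity of
    \<open>phi_hat\<close> to check.\<close>
  then show ?thesis using assms by (simp add: eta_def phi_hat_nonneg)
next
  case False
  define j where "j = nat (k mod int n)"
  have j: "j < n" and "int j = k mod int n"
    using assms by (auto simp: j_def nat_less_iff)
  \<comment> \<open>The successor wraps from \<open>n - 1\<close> to \<open>0\<close>, matching the
    cyclic index in \<open>eta\<close>.\<close>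
  then have succ: "nat ((k + 1) mod int n) = (j + 1) mod n"
    by (metis mod_add_left_eq nat_int of_nat_1 of_nat_add of_nat_mod)
  have "a > 0" using False assms by simp
  have pos: "phi_hat n a i > 0" for i using \<open>a > 0\<close> assms by (simp add: phi_hat_pos)
  have "eta n a \<le> phi_ratio n a ((j + 1) mod n) / phi_ratio n a j"
    using j False by (auto simp: eta_def)
  also have "\<dots> = phi_hat n a ((j + 1) mod n) / phi_hat n a j"
    using pos[of 0] by (simp add: phi_ratio_def)
  finally show ?thesis
    using pos[of j] unfolding succ j_def[symmetric] by (simp add: field_simps)
qed

lemma phi_hat_neighbour_ge:
  assumes "n > 0" and "a \<ge> 0" and "d \<in> {-1, 1}"
  shows "phi_hat n a (nat ((k + d) mod int n)) \<ge> eta n a * phi_hat n a (nat (k mod int n))"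
  \<comment> \<open>For \<open>d = -1\<close>, the upward step from \<open>- k\<close> ends at
    \<open>- (k - 1)\<close>; evenness at \<open>k\<close> and at \<open>k - 1\<close> turns it into
    the downward step from \<open>k\<close>.\<close>
  using assms phi_hat_Suc_ge[of n a k] phi_hat_Suc_ge[of n a "- k"]
    phi_hat_uminus[of n a k] phi_hat_uminus[of n a "k - 1"] by auto

text \<open>For \<open>a > 0\<close> everything is explicit: the values of \<open>psi\<close> are
  the even and odd parts of the exponential, and the two ratios in \<open>eta\<close> become
  \<open>tanh (2 * a)\<close> and its reciprocal, the first being smaller because it is below
  1.\<close>

lemma tanh_le_eta:
  assumes "a \<ge> 0"
  shows "tanh (2 * a) \<le> eta 2 a"
proof (cases "a = 0")
  case False
  then have "a > 0" using assms by simp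
  \<comment> \<open>The square roots of unity \<open>1\<close> and \<open>-1\<close> give two linear
    equations for the two values of \<open>psi\<close>.\<close>
  have e: "exp (of_real a) = (of_real (psi 2 a 0 + psi 2 a 1) :: complex)"
    "exp (- of_real a) = (of_real (psi 2 a 0 - psi 2 a 1) :: complex)"
    using exp_root_of_unity_eq_psi[of 2 a 1] exp_root_of_unity_eq_psi[of 2 a "-1"] assms
    by (simp_all add: numeral_2_eq_2)
  then have "exp a = psi 2 a 0 + psi 2 a 1" "exp (- a) = psi 2 a 0 - psi 2 a 1"
    by (metis exp_of_real of_real_eq_iff, metis exp_of_real of_real_eq_iff of_real_minus)
  then have psi: "psi 2 a 0 = cosh a" "psi 2 a 1 = sinh a"
    by (auto simp: cosh_def sinh_def)
  have two: "{..<2::nat} = {0, 1}" by auto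
  \<comment> \<open>Equal indices give cosh^2 + sinh^2 and distinct ones 2 sinh cosh, so the
    duplication formulas apply.\<close>
  have ph: "phi_hat 2 a 0 = cosh (2 * a)" "phi_hat 2 a 1 = sinh (2 * a)"
    unfolding phi_hat_eq_double_sum two
    using psi by (simp_all add: cong_def power2_eq_square cosh_double sinh_double)
  have "eta 2 a = min (tanh (2 * a)) (1 / tanh (2 * a))"
    using False cosh_real_pos[of "2*a"] ph
    by (simp add: eta_def phi_ratio_def two tanh_def min.commute)
  moreover have "tanh (2 * a) \<le> 1 / tanh (2 * a)"
    using tanh_real_lt_1[of "2 * a"] \<open>a > 0\<close> by (simp add: le_divide_eq mult_le_one)
  ultimately show ?thesis by simp
qed (simp add: eta_def)

section \<open>Primitive roots of unity and Fourier sums on the cyclic group\<close>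

locale primitive_root =
  fixes n :: nat and \<zeta> :: complex
  assumes n_pos: "n > 0" and root: "\<zeta> ^ n = 1"
    and primitive: "\<And>j. 0 < j \<Longrightarrow> j < n \<Longrightarrow> \<zeta> ^ j \<noteq> 1"
begin

lemma nonzero: "\<zeta> \<noteq> 0"
  using root n_pos by (auto simp: power_0_left)

lemma norm_one: "norm \<zeta> = 1"
  by (metis root n_pos norm_one norm_power power_eq_1_iff norm_ge_zero less_not_refl)

lemma powi_mod: "\<zeta> powi (k mod int n) = \<zeta> powi k"
proof -
  have "\<zeta> powi k = \<zeta> powi (int n * (k div int n) + k mod int n)" by simp
  also have "\<dots> = \<zeta> powi (k mod int n)"
    using nonzero root by (subst power_int_add) (auto simp: power_int_mult)
  finally show ?thesis by simp
qed

lemma powi_cong: "[k = l] (mod int n) \<Longrightarrow> \<zeta> powi k = \<zeta> powi l"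
  by (metis powi_mod cong_def)

lemma cnj_powi: "cnj (\<zeta> powi k) = \<zeta> powi (- k)"
proof -
  have "norm (\<zeta> powi k) = 1" by (simp add: norm_power_int norm_one)
  then have "\<zeta> powi k * cnj (\<zeta> powi k) = 1"
    unfolding complex_norm_square[symmetric] by simp
  then show ?thesis
    by (simp add: power_int_minus inverse_unique)
qed

lemma powi_eq_1_iff: "\<zeta> powi k = 1 \<longleftrightarrow> int n dvd k"
proof -
  have "\<zeta> powi k = \<zeta> ^ nat (k mod int n)"
    using n_pos by (metis powi_mod power_int_nonneg_exp pos_mod_sign of_nat_0_less_iff)
  moreover have "nat (k mod int n) < n" using n_pos by (simp add: nat_less_iff)
  ultimately have "\<zeta> powi k = 1 \<longleftrightarrow> nat (k mod int n) = 0"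
    using primitive[of "nat (k mod int n)"] by fastforce
  then show ?thesis using n_pos by (simp add: dvd_eq_mod_eq_0 order_antisym_conv)
qed

text \<open>Orthogonality of characters: the geometric sum has a ratio whose n-th power is 1, so it
  vanishes unless the ratio itself is 1.\<close>

lemma sum_powi: "(\<Sum>x=0..<int n. \<zeta> powi (k * x)) = (if int n dvd k then of_nat n else 0)"
proof -
  have "{0..<int n} = int ` {..<n}"
    by (metis image_int_atLeastLessThan lessThan_atLeast0 of_nat_0)
  then have "(\<Sum>x=0..<int n. \<zeta> powi (k * x)) = (\<Sum>x<n. (\<zeta> powi k) ^ x)"
    by (simp add: sum.reindex power_int_mult)
  moreover have "(\<zeta> powi k) ^ n = 1"
    by (metis root power_int_power' mult.commute power_int_mult power_int_of_nat power_int_1_left)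
  ultimately show ?thesis
    using powi_eq_1_iff[of k] geometric_sum[of "\<zeta> powi k" n] by (cases "int n dvd k") auto
qed

text \<open>Both exponentials expand into powers of the root, with opposite signs in the exponent.
  Summing over \<open>x\<close> kills all pairs \<open>(i, j)\<close> except those with
  \<open>j - i\<close> congruent to \<open>k\<close>, which are the pairs indexing
  \<open>phi_hat\<close>.\<close>

lemma edge_weight_fourier:
  assumes "a \<ge> 0"
  shows "(\<Sum>x=0..<int n. exp (of_real a * (\<zeta> powi x + \<zeta> powi (- x))) * \<zeta> powi (k * x)) =
    of_real (real n * phi_hat n a (nat (k mod int n)))"
proof -
  have exp_eq: "exp (of_real a * \<zeta> powi x) = (\<Sum>j<n. of_real (psi n a j) * \<zeta> powi (x * int j))" for x
  proof -
    have "(\<zeta> powi x) ^ n = 1"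
      by (metis root power_int_power' mult.commute power_int_mult power_int_of_nat power_int_1_left)
    from exp_root_of_unity_eq_psi[OF n_pos assms this] show ?thesis
      by (simp add: power_int_mult)
  qed
  have "(\<Sum>x=0..<int n. exp (of_real a * (\<zeta> powi x + \<zeta> powi (- x))) * \<zeta> powi (k * x)) =
    (\<Sum>x=0..<int n. \<Sum>i<n. \<Sum>j<n. of_real (psi n a i * psi n a j) * \<zeta> powi ((k + int i - int j) * x))"
    unfolding distrib_left exp_add exp_eq sum_product sum_distrib_right
    using nonzero
    by (intro sum.cong refl)
      (simp add: power_int_add power_int_diff power_int_minus sum_distrib_left sum_distrib_right algebra_simps divide_simps)
  also have "\<dots> = (\<Sum>i<n. \<Sum>x=0..<int n. \<Sum>j<n. of_real (psi n a i * psi n a j) * \<zeta> powi ((k + int i - int j) * x))"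
    by (rule sum.swap)
  also have "\<dots> = (\<Sum>i<n. \<Sum>j<n. \<Sum>x=0..<int n. of_real (psi n a i * psi n a j) * \<zeta> powi ((k + int i - int j) * x))"
    by (intro sum.cong refl sum.swap)
  also have "\<dots> = (\<Sum>i<n. \<Sum>j<n. of_nat n * of_real (if [int j - int i = int (nat (k mod int n))] (mod int n)
     then psi n a i * psi n a j else 0))"
  proof (intro sum.cong refl)
    fix i j
    have "[int j - int i = int (nat (k mod int n))] (mod int n) \<longleftrightarrow> int n dvd k + int i - int j"
      using n_pos by (simp add: cong_def mod_eq_dvd_iff algebra_simps dvd_diff_commute)
    then show "(\<Sum>x=0..<int n. of_real (psi n a i * psi n a j) * \<zeta> powi ((k + int i - int j) * x)) =
      of_nat n * of_real (if [int j - int i = int (nat (k mod int n))] (mod int n)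
        then psi n a i * psi n a j else 0)"
      unfolding sum_distrib_left[symmetric] sum_powi by simp
  qed
  also have "\<dots> = of_real (real n * phi_hat n a (nat (k mod int n)))"
    unfolding phi_hat_eq_double_sum by (simp add: sum_distrib_left)
  finally show ?thesis .
qed

end

section \<open>Positivity of exponentially weighted sums\<close>

lemma sum_nonneg_Reals:
  fixes f :: "'a \<Rightarrow> complex"
  shows "(\<And>i. i \<in> I \<Longrightarrow> f i \<in> \<real>\<^sub>\<ge>\<^sub>0) \<Longrightarrow> sum f I \<in> \<real>\<^sub>\<ge>\<^sub>0"
  by (induction I rule: infinite_finite_induct) auto

text \<open>In the power series of the exponential each term, multiplied by \<open>f\<close>, is a
  nonnegative combination of members of \<open>X\<close>, against which \<open>v\<close> sums to
  something nonnegative. Pointwise, \<open>v\<close> may change sign.\<close>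

lemma sum_exp_nonneg_Reals:
  fixes v :: "'a \<Rightarrow> complex" and c :: real
  assumes mult: "\<And>f g. f \<in> X \<Longrightarrow> g \<in> X \<Longrightarrow> (\<lambda>s. f s * g s) \<in> X"
    and v: "\<And>f. f \<in> X \<Longrightarrow> (\<Sum>s\<in>S. v s * f s) \<in> \<real>\<^sub>\<ge>\<^sub>0"
    and "c \<ge> 0" and h: "\<And>i. i \<in> J \<Longrightarrow> h i \<in> X" and "f \<in> X"
  shows "(\<Sum>s\<in>S. v s * exp (of_real c * (\<Sum>i\<in>J. h i s)) * f s) \<in> \<real>\<^sub>\<ge>\<^sub>0"
proof -
  define A where "A s = of_real c * (\<Sum>i\<in>J. h i s)" for s
  \<comment> \<open>\<open>f\<close> is generalised because each induction step moves one factor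
    \<open>h i\<close> out of the power into \<open>f\<close>, using closure of \<open>X\<close>
    under products.\<close>
  have pow: "(\<Sum>s\<in>S. v s * A s ^ r * f s) \<in> \<real>\<^sub>\<ge>\<^sub>0" if "f \<in> X" for r f
    using that
  proof (induction r arbitrary: f)
    case (Suc r)
    have "(\<Sum>s\<in>S. v s * A s ^ Suc r * f s) =
        of_real c * (\<Sum>i\<in>J. \<Sum>s\<in>S. v s * A s ^ r * (h i s * f s))"
      by (subst sum.swap)
        (simp add: A_def[of "_ :: 'a"] sum_distrib_left sum_distrib_right algebra_simps del: mult_cancel_left)
    also have "\<dots> \<in> \<real>\<^sub>\<ge>\<^sub>0"
      using \<open>c \<ge> 0\<close> by (intro nonneg_Reals_mult_I sum_nonneg_Reals Suc mult h) auto
    finally show ?case .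
  qed (use v in simp)
  have "(\<lambda>M. \<Sum>r<M. of_real (1 / fact r) * (\<Sum>s\<in>S. v s * A s ^ r * f s)) \<longlonglongrightarrow>
      (\<Sum>s\<in>S. v s * exp (A s) * f s)"
  proof -
    have "(\<lambda>M. \<Sum>s\<in>S. v s * (\<Sum>r<M. A s ^ r /\<^sub>R fact r) * f s) \<longlonglongrightarrow>
        (\<Sum>s\<in>S. v s * exp (A s) * f s)"
      using exp_converges unfolding sums_def by (intro tendsto_intros) auto
    moreover have "(\<Sum>s\<in>S. v s * (\<Sum>r<M. A s ^ r /\<^sub>R fact r) * f s) =
        (\<Sum>r<M. of_real (1 / fact r) * (\<Sum>s\<in>S. v s * A s ^ r * f s))" for M
      unfolding sum_distrib_left sum_distrib_right
      by (subst sum.swap) (simp add: scaleR_conv_of_real algebra_simps divide_simps)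
    ultimately show ?thesis by simp
  qed
  moreover have "(\<Sum>r<M. of_real (1 / fact r) * (\<Sum>s\<in>S. v s * A s ^ r * f s)) \<in> \<real>\<^sub>\<ge>\<^sub>0" for M
    by (intro sum_nonneg_Reals nonneg_Reals_mult_I pow \<open>f \<in> X\<close>, subst nonneg_Reals_of_real_iff) auto
  \<comment> \<open>The sum is a limit of nonnegative partial sums, and the nonnegative reals are
    closed in the complex plane.\<close>
  ultimately show ?thesis
    unfolding A_def by (rule closed_sequentially[OF closed_nonneg_Reals_complex, rotated])
qed


section \<open>Chains on the lattice\<close>

text \<open>The pairing over the integers, before reduction modulo \<open>n\<close>, so that
  additivity is an equality rather than a congruence.\<close>

definition chain_sum :: "('c \<Rightarrow> int) \<Rightarrow> 'c chain \<Rightarrow> int" where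
  "chain_sum g q = (\<Sum>c\<in>Poly_Mapping.keys q. Poly_Mapping.lookup q c * g c)"

lemma form_ext_eq_chain_sum: "form_ext n \<omega> q = chain_sum (\<lambda>c. \<omega> (Fwd c)) q mod int n"
  by (simp add: form_ext_def chain_sum_def)

lemma chain_sum_eq_sum:
  assumes "finite C" and "Poly_Mapping.keys q \<subseteq> C"
  shows "chain_sum g q = (\<Sum>c\<in>C. Poly_Mapping.lookup q c * g c)"
  unfolding chain_sum_def using assms
  by (intro sum.mono_neutral_left) (auto simp: in_keys_iff)

lemma chain_sum_0 [simp]: "chain_sum g 0 = 0"
  by (simp add: chain_sum_def)

lemma chain_sum_frag_of [simp]: "chain_sum g (frag_of c) = g c"
  by (simp add: chain_sum_def)

lemma chain_sum_diff: "chain_sum g (q - r) = chain_sum g q - chain_sum g r"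
proof -
  let ?C = "Poly_Mapping.keys q \<union> Poly_Mapping.keys r"
  have "finite ?C" by simp
  then show ?thesis
    using keys_diff[of q r]
    by (simp add: chain_sum_eq_sum[of ?C] lookup_minus left_diff_distrib sum_subtractf)
qed

lemma chain_sum_uminus: "chain_sum g (- q) = - chain_sum g q"
  using chain_sum_diff[of g 0 q] by simp

lemma boundary1_uminus: "boundary1 (- q) = - boundary1 q"
  by (simp add: boundary1_def frag_extend_minus)

text \<open>Discrete Stokes: the inner function on edges is the coboundary of \<open>g\<close>. Both
  sides are additive in the chain, so generators suffice.\<close>

lemma chain_sum_boundary1:
  "chain_sum g (boundary1 q) = chain_sum (\<lambda>e. chain_sum g (boundary1 (frag_of e))) q"
  using subset_UNIV
  by (induction q rule: frag_induction) (simp_all add: boundary1_def frag_extend_diff chain_sum_diff)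

text \<open>The corners cancel in pairs once the two orders of shifting are identified. This is what
  removes \<open>\<phi>\<close> from the plaquette terms.\<close>

lemma boundary1_boundary2: "boundary1 (boundary2 (chain_of p)) = 0"
proof -
  have "boundary1 (boundary2 (frag_of c)) = 0" for c
  proof -
    obtain x i j where c: "c = (x, i, j)" by (cases c)
    have "shift (shift x j) i = shift (shift x i) j"
      by (auto simp: shift_def)
    then show ?thesis
      by (simp add: c boundary1_def boundary2_def frag_extend_add frag_extend_minus frag_extend_diff)
  qed
  then show ?thesis
    by (cases p) (simp_all add: boundary1_def boundary2_def frag_extend_minus)
qed

lemma keys_boundary2_subset_edges:
  assumes "p \<in> oriented_cells (plaquettes m N)"
  shows "Poly_Mapping.keys (boundary2 (chain_of p)) \<subseteq> edges m N"
proof -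
  have "Poly_Mapping.keys (boundary2 (frag_of c)) \<subseteq> edges m N" if c: "c \<in> plaquettes m N" for c
  proof -
    obtain x i j where [simp]: "c = (x, i, j)" by (cases c)
    have comm: "shift (shift x j) i = shift (shift x i) j"
      by (auto simp: shift_def)
    have "Poly_Mapping.keys (boundary2 (frag_of c)) \<subseteq>
        {(x, i), (shift x i, j), (shift x j, i), (x, j)}"
      unfolding boundary2_def
      by (auto dest!: subsetD[OF keys_add] subsetD[OF keys_diff] split: if_splits simp: in_keys_iff lookup_add lookup_minus)
    also have "\<dots> \<subseteq> edges m N"
      using c comm by (auto simp: plaquettes_def edges_def)
    finally show ?thesis .
  qed
  moreover have "boundary2 (- frag_of c) = - boundary2 (frag_of c)" for c
    by (simp add: boundary2_def frag_extend_minus)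
  moreover obtain c where "c \<in> plaquettes m N" "p = Fwd c \<or> p = Rev c"
    using assms unfolding oriented_cells_def by blast
  ultimately show ?thesis by (metis chain_of.simps keys_minus)
qed

section \<open>Finiteness and sums over both orientations\<close>

lemma finite_vertices: "finite (vertices m N)"
  unfolding vertices_def by (intro finite_PiE) auto

lemma finite_edges: "finite (edges m N)"
  by (rule finite_subset[of _ "vertices m N \<times> {..<m}"]) (auto simp: edges_def finite_vertices)

lemma sum_oriented_cells:
  assumes "finite C"
  shows "(\<Sum>c\<in>oriented_cells C. f c) = (\<Sum>c\<in>C. f (Fwd c) + f (Rev c))"
  unfolding oriented_cells_def using assms
  by (subst sum.union_disjoint) (auto simp: sum.reindex inj_on_def sum.distrib)

lemma sum_oriented_cells_real:
  fixes f :: "'c oriented \<Rightarrow> complex"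
  assumes "\<And>c. c \<in> C \<Longrightarrow> f (Rev c) = cnj (f (Fwd c))"
  shows "(\<Sum>c\<in>oriented_cells C. f c) \<in> \<real>"
proof (cases "finite C")
  case True
  then show ?thesis
    using assms by (auto simp: sum_oriented_cells complex_add_cnj intro!: sum_in_Reals)
next
  case False
  \<comment> \<open>Over an infinite set the sum is zero by convention, which is real.\<close>
  then have "infinite (Fwd ` C)" by (simp add: finite_image_iff inj_on_def)
  then show ?thesis by (simp add: oriented_cells_def)
qed

section \<open>Forms\<close>

lemma form_Rev:
  assumes "\<sigma> \<in> forms n C" and "c \<in> C"
  shows "\<sigma> (Rev c) = (- \<sigma> (Fwd c)) mod int n"
proof -
  have "Fwd c \<in> oriented_cells C"
    using assms by (simp add: oriented_cells_def)
  then have "\<sigma> (Fwd c) \<in> carrier (integer_mod_group n)"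
    and "\<sigma> (opp (Fwd c)) = inv\<^bsub>integer_mod_group n\<^esub> \<sigma> (Fwd c)"
    using assms unfolding forms_def by blast+
  then show ?thesis by simp
qed

text \<open>Antisymmetry determines a form by its values on positive cells, and translation by
  \<open>t\<close> permutes residues. Later \<open>t\<close> is the differential of
  \<open>\<phi>\<close>; \<open>t = 0\<close> gives finiteness and nonemptiness of the set of
  forms.\<close>

lemma bij_betw_forms_shift:
  assumes "n > 0"
  shows "bij_betw (\<lambda>\<sigma>. \<lambda>c\<in>C. (\<sigma> (Fwd c) - t c) mod int n) (forms n C) (C \<rightarrow>\<^sub>E {0..<int n})"
\<comment> \<open>The inverse adds \<open>t\<close> back and extends to reversed cells by negation
  modulo \<open>n\<close>.\<close>
proof (rule bij_betw_byWitness[where f' = "\<lambda>s. \<lambda>c\<in>oriented_cells C.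
      case c of Fwd c \<Rightarrow> (s c + t c) mod int n | Rev c \<Rightarrow> (- (s c + t c)) mod int n"])
  have carrier: "carrier (integer_mod_group n) = {0..<int n}"
    using assms by (simp add: carrier_integer_mod_group)
  show "\<forall>\<sigma>\<in>forms n C. (\<lambda>c\<in>oriented_cells C.
      case c of Fwd c \<Rightarrow> ((\<lambda>c\<in>C. (\<sigma> (Fwd c) - t c) mod int n) c + t c) mod int n
        | Rev c \<Rightarrow> (- ((\<lambda>c\<in>C. (\<sigma> (Fwd c) - t c) mod int n) c + t c)) mod int n) = \<sigma>"
  proof
    fix \<sigma> assume \<sigma>: "\<sigma> \<in> forms n C"
    have mem: "\<sigma> c \<in> {0..<int n}" if "c \<in> oriented_cells C" for c
      using \<sigma> that carrier by (auto simp: forms_def)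
    have fwd: "((\<sigma> (Fwd c) - t c) mod int n + t c) mod int n = \<sigma> (Fwd c)" if "c \<in> C" for c
      using mem[of "Fwd c"] that by (simp add: mod_add_left_eq oriented_cells_def)
    have rev: "(- ((\<sigma> (Fwd c) - t c) mod int n + t c)) mod int n = \<sigma> (Rev c)" if "c \<in> C" for c
    proof -
      have "(- ((\<sigma> (Fwd c) - t c) mod int n + t c)) mod int n = (- \<sigma> (Fwd c)) mod int n"
        by (metis fwd[OF that] mod_minus_eq)
      also have "\<dots> = \<sigma> (Rev c)"
        using form_Rev[OF \<sigma> that] by simp
      finally show ?thesis .
    qed
    show "(\<lambda>c\<in>oriented_cells C.
      case c of Fwd c \<Rightarrow> ((\<lambda>c\<in>C. (\<sigma> (Fwd c) - t c) mod int n) c + t c) mod int n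
        | Rev c \<Rightarrow> (- ((\<lambda>c\<in>C. (\<sigma> (Fwd c) - t c) mod int n) c + t c)) mod int n) = \<sigma>" (is "?l = _")
    proof
      fix c
      show "?l c = \<sigma> c"
        using \<sigma> fwd rev by (cases c) (auto simp: forms_def oriented_cells_def PiE_def extensional_def)
    qed
  qed
  show "\<forall>s\<in>C \<rightarrow>\<^sub>E {0..<int n}. (\<lambda>c\<in>C. ((\<lambda>c\<in>oriented_cells C.
      case c of Fwd c \<Rightarrow> (s c + t c) mod int n | Rev c \<Rightarrow> (- (s c + t c)) mod int n) (Fwd c) - t c) mod int n) = s"
  proof
    fix s assume s: "s \<in> C \<rightarrow>\<^sub>E {0..<int n}"
    then have "s c mod int n = s c" if "c \<in> C" for c
      using that by (intro mod_pos_pos_trivial) (auto simp: PiE_iff)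
    with s show "(\<lambda>c\<in>C. ((\<lambda>c\<in>oriented_cells C.
      case c of Fwd c \<Rightarrow> (s c + t c) mod int n | Rev c \<Rightarrow> (- (s c + t c)) mod int n) (Fwd c) - t c) mod int n) = s"
      by (intro ext) (auto simp: oriented_cells_def mod_diff_left_eq PiE_def extensional_def)
  qed
  show "(\<lambda>\<sigma>. \<lambda>c\<in>C. (\<sigma> (Fwd c) - t c) mod int n) ` forms n C \<subseteq> C \<rightarrow>\<^sub>E {0..<int n}"
    using assms by auto
  show "(\<lambda>s. \<lambda>c\<in>oriented_cells C.
      case c of Fwd c \<Rightarrow> (s c + t c) mod int n | Rev c \<Rightarrow> (- (s c + t c)) mod int n) ` (C \<rightarrow>\<^sub>E {0..<int n})
      \<subseteq> forms n C"
  proof (rule image_subsetI)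
    fix s
    let ?f = "\<lambda>c\<in>oriented_cells C.
      case c of Fwd c \<Rightarrow> (s c + t c) mod int n | Rev c \<Rightarrow> (- (s c + t c)) mod int n"
    have mem: "?f c \<in> {0..<int n}" if "c \<in> oriented_cells C" for c
      using that assms by (cases c) simp_all
    have "?f (opp c) = inv\<^bsub>integer_mod_group n\<^esub> ?f c" if c: "c \<in> oriented_cells C" for c
    proof -
      have "inv\<^bsub>integer_mod_group n\<^esub> ?f c = (- ?f c) mod int n"
        using mem[OF c] by (intro inv_integer_mod_group) (simp only: carrier)
      also have "\<dots> = ?f (opp c)"
        using c by (cases c) (auto simp: oriented_cells_def mod_minus_eq add.commute)
      finally show ?thesis by (rule sym)
    qed
    then show "?f \<in> forms n C"
      using mem carrier unfolding forms_def by (intro CollectI conjI PiE_I ballI) (auto simp only: restrict_apply if_False)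
  qed
qed

lemma finite_forms: "n > 0 \<Longrightarrow> finite C \<Longrightarrow> finite (forms n C)"
  using bij_betw_finite[OF bij_betw_forms_shift[where n = n and C = C and t = "\<lambda>_. 0"]] by (simp add: finite_PiE)

lemma forms_nonempty:
  assumes "n > 0"
  shows "forms n C \<noteq> {}"
proof -
  have "C \<rightarrow>\<^sub>E {0..<int n} \<noteq> {}"
    using assms by (simp add: PiE_eq_empty_iff)
  then show ?thesis
    using bij_betw_imp_surj_on[OF bij_betw_forms_shift[OF assms, where C = C and t = "\<lambda>_. 0"]] by auto
qed

section \<open>Characters and the unitary gauge\<close>

context primitive_root
begin

text \<open>A character of the product of cyclic groups over \<open>E\<close>. Frequencies stay
  integers, so adding them needs no reduction.\<close>

definition character :: "'e set \<Rightarrow> ('e \<Rightarrow> int) \<Rightarrow> ('e \<Rightarrow> int) \<Rightarrow> complex" where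
  "character E k s = \<zeta> powi (\<Sum>e\<in>E. k e * s e)"

lemma character_add: "character E (\<lambda>e. k e + l e) s = character E k s * character E l s"
  unfolding character_def using nonzero
  by (simp add: power_int_add[symmetric] distrib_right sum.distrib)

lemma powi_sum: "\<zeta> powi (sum f A) = (\<Prod>i\<in>A. \<zeta> powi f i)"
  by (induction A rule: infinite_finite_induct) (simp_all add: power_int_add nonzero)

text \<open>The summand is a product of functions of the single values \<open>s e\<close>, so the
  sum over all fields factorises into one-edge Fourier coefficients.\<close>

lemma sum_edge_weight_character:
  assumes "finite E" and "a \<ge> 0"
  shows "(\<Sum>s\<in>E \<rightarrow>\<^sub>E {0..<int n}.
      exp (of_real a * (\<Sum>e\<in>E. \<zeta> powi s e + \<zeta> powi (- s e))) * character E k s) =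
    of_real (\<Prod>e\<in>E. real n * phi_hat n a (nat (k e mod int n)))"
proof -
  have "exp (of_real a * (\<Sum>e\<in>E. \<zeta> powi s e + \<zeta> powi (- s e))) * character E k s =
      (\<Prod>e\<in>E. exp (of_real a * (\<zeta> powi s e + \<zeta> powi (- s e))) * \<zeta> powi (k e * s e))" for s
    using assms by (simp add: character_def powi_sum sum_distrib_left exp_sum prod.distrib)
  then have "(\<Sum>s\<in>E \<rightarrow>\<^sub>E {0..<int n}.
      exp (of_real a * (\<Sum>e\<in>E. \<zeta> powi s e + \<zeta> powi (- s e))) * character E k s) =
    (\<Prod>e\<in>E. \<Sum>x=0..<int n. exp (of_real a * (\<zeta> powi x + \<zeta> powi (- x))) * \<zeta> powi (k e * x))"
    using assms by (simp add: prod_sum_PiE)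
  then show ?thesis
    using assms by (simp add: edge_weight_fourier)
qed

text \<open>The comparison itself, free of lattice geometry: plaquettes appear only through the
  characters with frequencies \<open>q j\<close>. Membership in the nonnegative reals records both
  reality and sign of the difference.\<close>

lemma unitary_gauge_bounds:
  fixes k0 :: "'e \<Rightarrow> int" and q :: "'j \<Rightarrow> 'e \<Rightarrow> int" and J :: "'j set"
  assumes "finite E" and "a \<ge> 0" and "b \<ge> 0" and k0: "\<And>e. e \<in> E \<Longrightarrow> k0 e \<in> {-1, 0, 1}"
  defines "w \<equiv> \<lambda>s. exp (of_real a * (\<Sum>e\<in>E. \<zeta> powi s e + \<zeta> powi (- s e))) *
    exp (of_real b * (\<Sum>j\<in>J. character E (q j) s))"
  shows "(\<Sum>s\<in>E \<rightarrow>\<^sub>E {0..<int n}. w s * character E k0 s)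
      - of_real (eta n a ^ card {e \<in> E. k0 e \<noteq> 0}) * (\<Sum>s\<in>E \<rightarrow>\<^sub>E {0..<int n}. w s) \<in> \<real>\<^sub>\<ge>\<^sub>0"
proof -
  define S where "S = E \<rightarrow>\<^sub>E {0..<int n}"
  define u where "u s = exp (of_real a * (\<Sum>e\<in>E. \<zeta> powi s e + \<zeta> powi (- s e)))" for s
  define c where "c = eta n a ^ card {e \<in> E. k0 e \<noteq> 0}"
  let ?p = "\<lambda>k. \<Prod>e\<in>E. real n * phi_hat n a (nat (k e mod int n))"
  have base: "(\<Sum>s\<in>S. u s * character E k s) = of_real (?p k)" for k
    unfolding S_def u_def using assms by (intro sum_edge_weight_character)
  \<comment> \<open>Edge by edge: where \<open>k0\<close> is nonzero the frequency moves by one and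
    costs a factor \<open>eta n a\<close>; elsewhere nothing changes.\<close>
  have shifted: "c * ?p k \<le> ?p (\<lambda>e. k0 e + k e)" for k
  proof -
    have "c = (\<Prod>e\<in>E. if k0 e \<noteq> 0 then eta n a else 1)"
      unfolding c_def using \<open>finite E\<close>
      by (subst prod.inter_filter[symmetric]) simp_all
    then have "c * ?p k = (\<Prod>e\<in>E. real n * ((if k0 e \<noteq> 0 then eta n a else 1) * phi_hat n a (nat (k e mod int n))))"
      unfolding prod.distrib[symmetric] by (simp only: prod.distrib[symmetric] mult.left_commute)
    also have "\<dots> \<le> ?p (\<lambda>e. k0 e + k e)"
    proof (intro prod_mono conjI mult_left_mono)
      fix e assume "e \<in> E"
      show "0 \<le> real n * ((if k0 e \<noteq> 0 then eta n a else 1) * phi_hat n a (nat (k e mod int n)))"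
        using n_pos \<open>a \<ge> 0\<close> by (simp add: eta_nonneg phi_hat_nonneg)
      show "(if k0 e \<noteq> 0 then eta n a else 1) * phi_hat n a (nat (k e mod int n)) \<le>
          phi_hat n a (nat ((k0 e + k e) mod int n))"
        using phi_hat_neighbour_ge[OF n_pos \<open>a \<ge> 0\<close>, of "k0 e" "k e"] k0[OF \<open>e \<in> E\<close>]
        by (cases "k0 e = 0") (simp_all add: add.commute[of "k0 e"])
    qed simp
    finally show ?thesis .
  qed
  \<comment> \<open>The Fourier coefficients of this combination are the differences bounded in
    \<open>shifted\<close>, hence nonnegative, although \<open>v\<close> itself has no sign. The
    trivial character below serves as the test function.\<close>
  define v where "v s = u s * (character E k0 s - of_real c)" for s
  have "(\<Sum>s\<in>S. v s * exp (of_real b * (\<Sum>j\<in>J. character E (q j) s)) * character E (\<lambda>_. 0) s) \<in> \<real>\<^sub>\<ge>\<^sub>0"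
  proof (rule sum_exp_nonneg_Reals[where X = "range (character E)"])
    show "(\<lambda>s. f s * g s) \<in> range (character E)"
      if "f \<in> range (character E)" "g \<in> range (character E)" for f g
      using that by (auto simp: character_add[symmetric])
    show "(\<Sum>s\<in>S. v s * f s) \<in> \<real>\<^sub>\<ge>\<^sub>0" if f: "f \<in> range (character E)" for f
    proof -
      obtain k where k: "f = character E k" using f by auto
      have "(\<Sum>s\<in>S. v s * f s) = (\<Sum>s\<in>S. u s * character E (\<lambda>e. k0 e + k e) s)
          - of_real c * (\<Sum>s\<in>S. u s * character E k s)"
        by (simp add: v_def k character_add algebra_simps sum_subtractf sum_distrib_left)
      also have "\<dots> = of_real (?p (\<lambda>e. k0 e + k e) - c * ?p k)"
        unfolding base by simp
      finally show ?thesis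
        using shifted[of k] by (simp only: nonneg_Reals_of_real_iff)
    qed
  qed (use \<open>b \<ge> 0\<close> in auto)
  moreover have "v s * exp (of_real b * (\<Sum>j\<in>J. character E (q j) s)) * character E (\<lambda>_. 0) s =
      w s * character E k0 s - of_real c * w s" for s
    by (simp add: v_def w_def u_def character_def[of E "\<lambda>_. 0"] algebra_simps)
  ultimately show ?thesis
    by (simp add: S_def c_def sum_subtractf sum_distrib_left)
qed

end

section \<open>The representation and the weight in the unitary gauge\<close>

lemma faithful_unitary_rep_primitive_root:
  assumes "n \<ge> 2" and "faithful_unitary_rep n \<rho>"
  shows "primitive_root n (\<rho> 1)" and "\<rho> (k mod int n) = \<rho> 1 powi k"
proof -
  have carrier: "carrier (integer_mod_group n) = {0..<int n}"
    using assms by (simp add: carrier_integer_mod_group)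
  have hom: "\<rho> ((x + y) mod int n) = \<rho> x * \<rho> y" and norm: "norm (\<rho> x) = 1"
    if "x \<in> {0..<int n}" "y \<in> {0..<int n}" for x y
    using assms that carrier
    by (auto simp: faithful_unitary_rep_def mon_def hom_def unit_circle_group_def)
  have inj: "inj_on \<rho> {0..<int n}"
    using assms carrier by (simp add: faithful_unitary_rep_def mon_def)
  have zero: "\<rho> 0 = 1"
    using hom[of 0 0] norm[of 0 0] assms by auto
  have pow: "\<rho> (int j) = \<rho> 1 ^ j" if "j < n" for j
    using that
  proof (induction j)
    case (Suc j)
    then show ?case using hom[of "int j" 1] by (simp add: add.commute)
  qed (simp add: zero)
  show root: "primitive_root n (\<rho> 1)"
  proof
    \<comment> \<open>\<open>pow\<close> reaches only exponents below \<open>n\<close>, so one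
      factor is split off, and \<open>n - 1\<close> plus \<open>1\<close> wraps to \<open>0\<close>
      in the group.\<close>
    have "\<rho> 1 ^ n = \<rho> (int (n - 1)) * \<rho> 1"
      using assms power_minus_mult[of n "\<rho> 1"] by (subst pow) simp_all
    also have "\<dots> = 1"
      using hom[of "int (n - 1)" 1] assms zero by (simp add: of_nat_diff)
    finally show "\<rho> 1 ^ n = 1" .
    fix j assume j: "0 < j" "j < n"
    \<comment> \<open>Faithfulness is what makes the root primitive.\<close>
    then have "\<rho> (int j) \<noteq> \<rho> 0"
      using inj_onD[OF inj, of "int j" 0] by auto
    then show "\<rho> 1 ^ j \<noteq> 1" using pow[OF j(2)] zero by simp
  qed (use assms in simp)
  have "k mod int n = int (nat (k mod int n))" "nat (k mod int n) < n"
    using assms by (auto simp: nat_less_iff)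
  then have "\<rho> (k mod int n) = \<rho> 1 powi (k mod int n)"
    by (metis pow power_int_of_nat)
  then show "\<rho> (k mod int n) = \<rho> 1 powi k"
    using primitive_root.powi_mod[OF root] by simp
qed

text \<open>The gauge-invariant difference of \<open>\<sigma>\<close> and the differential of
  \<open>\<phi>\<close>. Reduction modulo \<open>n\<close> and restriction to \<open>E\<close> place
  it in the extensional function space over which the Fourier sums run.\<close>

definition unitary_gauge ::
  "nat \<Rightarrow> edge set \<Rightarrow> (edge oriented \<Rightarrow> int) \<Rightarrow> (vertex oriented \<Rightarrow> int) \<Rightarrow> edge \<Rightarrow> int" where
  "unitary_gauge n E \<sigma> \<phi> =
     (\<lambda>e\<in>E. (\<sigma> (Fwd e) - chain_sum (\<lambda>x. \<phi> (Fwd x)) (boundary1 (frag_of e))) mod int n)"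

text \<open>Discrete Stokes collects the \<open>\<phi>\<close> contributions of the edges into the
  boundary of \<open>q\<close>; reducing each edge modulo \<open>n\<close> leaves a congruence,
  which is enough for powers of the root.\<close>

lemma chain_sum_unitary_gauge:
  assumes "finite E" and "Poly_Mapping.keys q \<subseteq> E"
  shows "[chain_sum (unitary_gauge n E \<sigma> \<phi>) q =
    chain_sum (\<lambda>e. \<sigma> (Fwd e)) q - chain_sum (\<lambda>x. \<phi> (Fwd x)) (boundary1 q)] (mod int n)"
proof -
  have "chain_sum (\<lambda>e. \<sigma> (Fwd e)) q - chain_sum (\<lambda>x. \<phi> (Fwd x)) (boundary1 q) =
    (\<Sum>e\<in>E. Poly_Mapping.lookup q e *
      (\<sigma> (Fwd e) - chain_sum (\<lambda>x. \<phi> (Fwd x)) (boundary1 (frag_of e))))"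
    using assms by (simp add: chain_sum_boundary1[of _ q] chain_sum_eq_sum[of E] right_diff_distrib sum_subtractf)
  moreover have "[(\<Sum>e\<in>E. Poly_Mapping.lookup q e * unitary_gauge n E \<sigma> \<phi> e) = \<dots>] (mod int n)"
    by (intro cong_sum) (simp add: unitary_gauge_def cong_def mod_mult_right_eq)
  ultimately show ?thesis
    using assms by (simp add: chain_sum_eq_sum[of E])
qed

context primitive_root
begin

lemma character_eq_chain_sum:
  "finite E \<Longrightarrow> Poly_Mapping.keys q \<subseteq> E \<Longrightarrow>
    character E (Poly_Mapping.lookup q) s = \<zeta> powi chain_sum s q"
  by (simp add: character_def chain_sum_eq_sum)

text \<open>Edge terms see \<open>\<sigma>\<close> and \<open>\<phi>\<close> only through their
  gauge-invariant difference, and plaquette terms lose \<open>\<phi>\<close> because a boundary has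
  no boundary. The result has the shape treated in \<open>unitary_gauge_bounds\<close>.\<close>

lemma weight_unitary_gauge:
  fixes m N :: nat and \<phi> :: "vertex oriented \<Rightarrow> int"
  assumes rep: "\<And>k. \<rho> (k mod int n) = \<zeta> powi k" and \<sigma>: "\<sigma> \<in> forms n (edges m N)"
  defines "E \<equiv> edges m N" and "s \<equiv> unitary_gauge n (edges m N) \<sigma> \<phi>"
  shows "of_real (weight m n N \<rho> \<beta> \<kappa> (\<sigma>, \<phi>)) =
    exp (of_real \<kappa> * (\<Sum>e\<in>E. \<zeta> powi s e + \<zeta> powi (- s e))) *
    exp (of_real \<beta> * (\<Sum>p\<in>oriented_cells (plaquettes m N).
      character E (Poly_Mapping.lookup (boundary2 (chain_of p))) s))"
proof -
  have "finite E" by (simp add: E_def finite_edges)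
  have plaq: "\<rho> (d_form n \<sigma> p) = character E (Poly_Mapping.lookup (boundary2 (chain_of p))) s"
    if "p \<in> oriented_cells (plaquettes m N)" for p
  proof -
    have keys: "Poly_Mapping.keys (boundary2 (chain_of p)) \<subseteq> E"
      unfolding E_def by (rule keys_boundary2_subset_edges) fact
    have "[chain_sum s (boundary2 (chain_of p)) =
        chain_sum (\<lambda>e. \<sigma> (Fwd e)) (boundary2 (chain_of p))] (mod int n)"
      using chain_sum_unitary_gauge[OF \<open>finite E\<close> keys, of n \<sigma> \<phi>]
      by (simp add: boundary1_boundary2 s_def E_def)
    then show ?thesis
      using keys \<open>finite E\<close>
      by (simp add: d_form_def form_ext_eq_chain_sum rep character_eq_chain_sum powi_cong)
  qed
  define F where "F e = \<rho> ((\<sigma> e - form_ext n \<phi> (boundary1 (chain_of e))) mod int n)" for e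
  have fwd: "F (Fwd e) = \<zeta> powi s e" if "e \<in> E" for e
    using that by (simp add: F_def s_def E_def unitary_gauge_def form_ext_eq_chain_sum
        mod_diff_right_eq powi_mod rep)
  have rev: "F (Rev e) = \<zeta> powi (- s e)" if "e \<in> E" for e
  proof -
    have "\<sigma> (Rev e) = (- \<sigma> (Fwd e)) mod int n"
      using \<sigma> that by (intro form_Rev) (simp_all add: E_def)
    then have "F (Rev e) = \<zeta> powi (- (\<sigma> (Fwd e) - chain_sum (\<lambda>x. \<phi> (Fwd x)) (boundary1 (frag_of e))))"
      by (simp add: F_def form_ext_eq_chain_sum mod_diff_eq rep boundary1_uminus chain_sum_uminus)
    also have "\<dots> = \<zeta> powi (- s e)"
      using that by (intro powi_cong) (simp add: s_def E_def unitary_gauge_def cong_def mod_minus_eq)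
    finally show ?thesis .
  qed
  have edge: "(\<Sum>e\<in>oriented_cells E. F e) = (\<Sum>e\<in>E. \<zeta> powi s e + \<zeta> powi (- s e))"
    using \<open>finite E\<close> fwd rev by (simp add: sum_oriented_cells)
  have exponent: "exponent m n N \<rho> \<beta> \<kappa> (\<sigma>, \<phi>) =
      of_real \<beta> * (\<Sum>p\<in>oriented_cells (plaquettes m N).
        character E (Poly_Mapping.lookup (boundary2 (chain_of p))) s) +
      of_real \<kappa> * (\<Sum>e\<in>E. \<zeta> powi s e + \<zeta> powi (- s e))"
    using plaq edge by (simp add: exponent_def F_def E_def)
  \<comment> \<open>The two orientations of a cell contribute conjugates, so the real part taken in
    \<open>weight\<close> loses nothing and the complex exponential may be used.\<close>
  have "exponent m n N \<rho> \<beta> \<kappa> (\<sigma>, \<phi>) \<in> \<real>"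
    unfolding exponent
  proof (intro Reals_add Reals_mult Reals_of_real sum_oriented_cells_real)
    fix p
    show "character E (Poly_Mapping.lookup (boundary2 (chain_of (Rev p)))) s =
        cnj (character E (Poly_Mapping.lookup (boundary2 (chain_of (Fwd p)))) s)"
      unfolding character_def cnj_powi by (simp add: boundary2_def frag_extend_minus sum_negf)
    show "(\<Sum>e\<in>E. \<zeta> powi s e + \<zeta> powi (- s e)) \<in> \<real>"
      by (intro sum_in_Reals) (simp only: cnj_powi[symmetric] complex_add_cnj Reals_of_real)
  qed
  then have "of_real (weight m n N \<rho> \<beta> \<kappa> (\<sigma>, \<phi>)) = exp (exponent m n N \<rho> \<beta> \<kappa> (\<sigma>, \<phi>))"
    by (metis weight_def exp_of_real of_real_Re)
  then show ?thesis
    by (simp add: exponent exp_add mult.commute)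
qed

lemma wilson_line_unitary_gauge:
  assumes rep: "\<And>k. \<rho> (k mod int n) = \<zeta> powi k"
    and "finite E" and "Poly_Mapping.keys \<gamma> \<subseteq> E"
  shows "wilson_line n \<rho> \<gamma> (\<sigma>, \<phi>) =
    character E (Poly_Mapping.lookup \<gamma>) (unitary_gauge n E \<sigma> \<phi>)"
  using assms powi_cong[OF chain_sum_unitary_gauge[of E \<gamma> n \<sigma> \<phi>]]
  by (simp add: wilson_line_def form_ext_eq_chain_sum mod_diff_eq rep character_eq_chain_sum)

end

section \<open>Expectations as gauge-fixed sums\<close>

lemma sum_configs_unitary_gauge:
  fixes F :: "(edge \<Rightarrow> int) \<Rightarrow> complex"
  assumes "n > 0"
  shows "(\<Sum>(\<sigma>, \<phi>)\<in>configs m n N. F (unitary_gauge n (edges m N) \<sigma> \<phi>)) =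
    of_nat (card (forms n (vertices m N))) * (\<Sum>s\<in>edges m N \<rightarrow>\<^sub>E {0..<int n}. F s)"
proof -
  have "(\<Sum>(\<sigma>, \<phi>)\<in>configs m n N. F (unitary_gauge n (edges m N) \<sigma> \<phi>)) =
      (\<Sum>\<phi>\<in>forms n (vertices m N). \<Sum>\<sigma>\<in>forms n (edges m N). F (unitary_gauge n (edges m N) \<sigma> \<phi>))"
    unfolding configs_def sum.cartesian_product[symmetric] by (rule sum.swap)
  \<comment> \<open>For fixed \<open>\<phi>\<close>, translation by its differential maps the forms
    \<open>\<sigma>\<close> bijectively onto the gauge-fixed fields, so every \<open>\<phi>\<close>
    contributes the same sum.\<close>
  also have "\<dots> = (\<Sum>\<phi>\<in>forms n (vertices m N). \<Sum>s\<in>edges m N \<rightarrow>\<^sub>E {0..<int n}. F s)"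
    unfolding unitary_gauge_def
    by (intro sum.cong refl sum.reindex_bij_betw bij_betw_forms_shift assms)
  finally show ?thesis by simp
qed

lemma wilson_expectation_eq_sum:
  assumes "n > 0"
  shows "wilson_expectation m n N \<rho> \<beta> \<kappa> \<gamma> =
    (\<Sum>\<omega>\<in>configs m n N. of_real (weight m n N \<rho> \<beta> \<kappa> \<omega>) * wilson_line n \<rho> \<gamma> \<omega>) /
    (\<Sum>\<omega>\<in>configs m n N. of_real (weight m n N \<rho> \<beta> \<kappa> \<omega>))"
proof -
  let ?Z = "\<Sum>\<omega>\<in>configs m n N. weight m n N \<rho> \<beta> \<kappa> \<omega>"
  have "finite (configs m n N)"
    using assms by (simp add: configs_def finite_forms finite_edges finite_vertices)
  moreover have "?Z \<ge> 0" by (intro sum_nonneg) (simp add: weight_def)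
  moreover have "weight m n N \<rho> \<beta> \<kappa> \<omega> \<ge> 0" for \<omega> by (simp add: weight_def)
  \<comment> \<open>Finiteness turns the integral into a sum, and nonnegativity lets the
    \<open>ennreal\<close> density be read as a real factor.\<close>
  ultimately have "wilson_expectation m n N \<rho> \<beta> \<kappa> \<gamma> =
      (\<Sum>\<omega>\<in>configs m n N. (weight m n N \<rho> \<beta> \<kappa> \<omega> / ?Z) *\<^sub>R wilson_line n \<rho> \<gamma> \<omega>)"
    unfolding wilson_expectation_def higgs_measure_def point_measure_def
    by (subst integral_density)
      (auto simp: lebesgue_integral_count_space_finite AE_count_space)
  then show ?thesis
    by (simp add: scaleR_conv_of_real sum_divide_distrib)
qed

text \<open>The number of forms \<open>\<phi>\<close> cancels between numerator and denominator,
  leaving \<open>unitary_gauge_bounds\<close> with the coefficients of \<open>\<gamma>\<close> as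
  the frequency shift \<open>k0\<close>.\<close>

lemma wilson_expectation_ge_eta_power:
  assumes "n \<ge> 2" and "\<beta> \<ge> 0" and "\<kappa> \<ge> 0"
    and "faithful_unitary_rep n \<rho>"
    and keys: "Poly_Mapping.keys \<gamma> \<subseteq> edges m N"
    and coeff: "\<And>e. Poly_Mapping.lookup \<gamma> e \<in> {-1, 0, 1}"
  shows "wilson_expectation m n N \<rho> \<beta> \<kappa> \<gamma> - of_real (eta n \<kappa> ^ path_length \<gamma>) \<in> \<real>\<^sub>\<ge>\<^sub>0"
proof -
  interpret primitive_root n "\<rho> 1"
    using assms by (intro faithful_unitary_rep_primitive_root)
  have rep: "\<rho> (k mod int n) = \<rho> 1 powi k" for k
    using assms by (intro faithful_unitary_rep_primitive_root)
  define E where "E = edges m N"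
  have "finite E" by (simp add: E_def finite_edges)
  define S where "S = E \<rightarrow>\<^sub>E {0..<int n}"
  define w where "w s = exp (of_real \<kappa> * (\<Sum>e\<in>E. \<rho> 1 powi s e + \<rho> 1 powi (- s e))) *
    exp (of_real \<beta> * (\<Sum>p\<in>oriented_cells (plaquettes m N).
      character E (Poly_Mapping.lookup (boundary2 (chain_of p))) s))" for s
  define L where "L = character E (Poly_Mapping.lookup \<gamma>)"
  define \<Phi> where "\<Phi> = card (forms n (vertices m N))"
  define Z where "Z = (\<Sum>\<omega>\<in>configs m n N. weight m n N \<rho> \<beta> \<kappa> \<omega>)"
  have weight: "of_real (weight m n N \<rho> \<beta> \<kappa> (\<sigma>, \<phi>)) = w (unitary_gauge n E \<sigma> \<phi>)"
    if "(\<sigma>, \<phi>) \<in> configs m n N" for \<sigma> \<phi>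
    unfolding w_def E_def using that by (intro weight_unitary_gauge rep) (simp add: configs_def)
  have line: "wilson_line n \<rho> \<gamma> (\<sigma>, \<phi>) = L (unitary_gauge n E \<sigma> \<phi>)" for \<sigma> \<phi>
    unfolding L_def using \<open>finite E\<close> keys by (intro wilson_line_unitary_gauge rep) (auto simp: E_def)
  have denominator: "of_real Z = of_nat \<Phi> * (\<Sum>s\<in>S. w s)"
  proof -
    have "of_real Z = (\<Sum>(\<sigma>, \<phi>)\<in>configs m n N. w (unitary_gauge n E \<sigma> \<phi>))"
      unfolding Z_def of_real_sum using weight by (intro sum.cong) auto
    then show ?thesis
      unfolding E_def \<Phi>_def S_def using sum_configs_unitary_gauge[OF n_pos, of w] by simp
  qed
  have numerator: "(\<Sum>\<omega>\<in>configs m n N. of_real (weight m n N \<rho> \<beta> \<kappa> \<omega>) * wilson_line n \<rho> \<gamma> \<omega>) =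
      of_nat \<Phi> * (\<Sum>s\<in>S. w s * L s)"
  proof -
    have "(\<Sum>\<omega>\<in>configs m n N. of_real (weight m n N \<rho> \<beta> \<kappa> \<omega>) * wilson_line n \<rho> \<gamma> \<omega>) =
        (\<Sum>(\<sigma>, \<phi>)\<in>configs m n N. w (unitary_gauge n E \<sigma> \<phi>) * L (unitary_gauge n E \<sigma> \<phi>))"
      using weight line by (intro sum.cong) auto
    then show ?thesis
      unfolding E_def \<Phi>_def S_def using sum_configs_unitary_gauge[OF n_pos, of "\<lambda>s. w s * L s"] by simp
  qed
  have "finite (configs m n N)" "configs m n N \<noteq> {}"
    using n_pos by (auto simp: configs_def finite_forms finite_edges finite_vertices forms_nonempty)
  then have "Z > 0"
    unfolding Z_def by (intro sum_pos) (auto simp: weight_def)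
  have length: "path_length \<gamma> = card {e \<in> E. Poly_Mapping.lookup \<gamma> e \<noteq> 0}"
    unfolding path_length_def using keys
    by (intro arg_cong[where f = card]) (auto simp: in_keys_iff E_def)
  have bound: "(\<Sum>s\<in>S. w s * L s) - of_real (eta n \<kappa> ^ path_length \<gamma>) * (\<Sum>s\<in>S. w s) \<in> \<real>\<^sub>\<ge>\<^sub>0"
    unfolding S_def w_def L_def length
    by (rule unitary_gauge_bounds) (use assms \<open>finite E\<close> coeff in auto)
  \<comment> \<open>This allows the constant to be brought over the common denominator.\<close>
  have "of_nat \<Phi> * (\<Sum>s\<in>S. w s) \<noteq> 0"
    using \<open>Z > 0\<close> unfolding denominator[symmetric] by simp
  then have "wilson_expectation m n N \<rho> \<beta> \<kappa> \<gamma> - of_real (eta n \<kappa> ^ path_length \<gamma>) =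
      of_nat \<Phi> * ((\<Sum>s\<in>S. w s * L s) - of_real (eta n \<kappa> ^ path_length \<gamma>) * (\<Sum>s\<in>S. w s)) / of_real Z"
    unfolding wilson_expectation_eq_sum[OF n_pos] numerator of_real_sum[symmetric] Z_def[symmetric]
    unfolding denominator by (simp add: right_diff_distrib diff_divide_distrib mult.left_commute)
  also have "\<dots> \<in> \<real>\<^sub>\<ge>\<^sub>0"
    using bound \<open>Z > 0\<close> by (intro nonneg_Reals_divide_I nonneg_Reals_mult_I) auto
  finally show ?thesis .
qed

theorem theorem1p1:
  fixes m n N :: nat and \<beta> \<kappa> :: real and \<rho> :: "int \<Rightarrow> complex" and \<gamma> :: "edge chain"
  assumes "m \<ge> 2" and "n \<ge> 2" and "N \<ge> 1"
    and "\<beta> \<ge> 0" and "\<kappa> \<ge> 0"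
    and "faithful_unitary_rep n \<rho>"
    and "lattice_path m N \<gamma>"
  shows "wilson_expectation m n N \<rho> \<beta> \<kappa> \<gamma> \<in> \<real> \<and>
    Re (wilson_expectation m n N \<rho> \<beta> \<kappa> \<gamma>) \<ge> eta n \<kappa> ^ path_length \<gamma> \<and>
    (n = 2 \<longrightarrow>
      Re (wilson_expectation m n N \<rho> \<beta> \<kappa> \<gamma>) \<ge> tanh (2 * \<kappa>) ^ path_length \<gamma>)"
proof -
  have "wilson_expectation m n N \<rho> \<beta> \<kappa> \<gamma> - of_real (eta n \<kappa> ^ path_length \<gamma>) \<in> \<real>\<^sub>\<ge>\<^sub>0"
    using assms by (intro wilson_expectation_ge_eta_power) (auto simp: lattice_path_def)
  then have "wilson_expectation m n N \<rho> \<beta> \<kappa> \<gamma> \<in> \<real>"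
    and "eta n \<kappa> ^ path_length \<gamma> \<le> Re (wilson_expectation m n N \<rho> \<beta> \<kappa> \<gamma>)"
    by (auto simp: complex_nonneg_Reals_iff complex_is_Real_iff)
  \<comment> \<open>Powers preserve the comparison because \<open>tanh (2 * \<kappa>)\<close> is
    nonnegative for \<open>\<kappa> \<ge> 0\<close>.\<close>
  moreover have "tanh (2 * \<kappa>) ^ path_length \<gamma> \<le> eta 2 \<kappa> ^ path_length \<gamma>"
    using assms by (intro power_mono tanh_le_eta) auto
  ultimately show ?thesis by auto
qed

end
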